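(* Let $G$ be a finite group with generating set $S=\{s_1,\dots,s_k\}$, $k\ge 1$, ordered $s_1<\dots<s_k$. Let $s:=\prod_{d=1}^k s_d=s_1s_2\cdots s_k$ be the product of all generators according to this ordering, and let $g\in G$ be the starting point. 1. The set $H_{\mathrm{vis}}$ computed together with the roof edge cycle of $D_{G,S}$ with starting point $g$ is exactly the left coset $g\langle s\rangle$. 2. For every $d\in[k]$, the set $\bar H_{\mathrm{vis}}$ computed together with the base edge cycle of $D_{G,S}$ with starting point $g$ and generator $s_d$ is exactly the left coset $g\langle s_d\rangle$.
   Context: Notation: $[k]=\{1,\dots,k\}$. For $d\in[k]$ put $d^+=d+1$ if $d<k$ and $k^+=1$. The Cayley graph $\mathrm{Cay}_{G,S}$ is the edge-coloured directed graph with vertex set $G$ and a directed edge $(g,gs_d)$ of colour $d$ for all $g\in G$, $d\in[k]$. $d$-chain: for an edge $(g,h)$ of colour $d$ (so $h=gs_d$), $\mathfrak{C}_{[d,g,h]}$ is the graph with $2d+10$ vertices labelled $u_1,\dots,u_d,\ell_1,\dots,\ell_d,0,1,\dots,9$ (the vertex with label $v$ is written $\mathfrak{C}_{[d,g,h]}(v)$) and edges (written via labels): $\{u_i,u_{i+1}\}$ and $\{\ell_i,\ell_{i+1}\}$ for $1\le i<d$; $\{u_i,\ell_i\}$ for $1\le i\le d$; $\{u_d,4\}$, $\{\ell_d,7\}$; and $\{0,1\},\{0,2\},\{0,3\},\{1,3\},\{1,6\},\{2,4\},\{2,5\},\{3,5\},\{4,7\},\{5,8\},\{6,9\},\{7,8\},\{8,9\}$.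 Blow-up graph $A_g$ of $g\in G$: - If $k\ge3$: vertices $a_g^{d.1},a_g^{d.2},a_g^{d.3},a_g^{d.4},c_g^{d.1},c_g^{d.2}$ for $d\in[k]$; edges, for each $d\in[k]$, $\{a_g^{d.1},a_g^{d.2}\}$, $\{a_g^{d.2},c_g^{d.1}\}$, $\{c_g^{d.1},a_g^{d.3}\}$, $\{a_g^{d.3},a_g^{d.4}\}$, $\{c_g^{d.1},c_g^{d.2}\}$, $\{c_g^{d.2},c_g^{d^+.2}\}$, $\{a_g^{d.4},a_g^{d^+.1}\}$. - If $k=2$: vertices $a_g^{d.1},\dots,a_g^{d.4},c_g^{d.1}$ for $d\in\{1,2\}$; edges $\{a_g^{d.1},a_g^{d.2}\}$, $\{a_g^{d.2},c_g^{d.1}\}$, $\{c_g^{d.1},a_g^{d.3}\}$, $\{a_g^{d.3},a_g^{d.4}\}$, $\{a_g^{d.4},a_g^{d^+.1}\}$ for $d\in\{1,2\}$, and $\{c_g^{1.1},c_g^{2.1}\}$. - If $k=1$: vertices $a_g^{1.1},\dots,a_g^{1.4}$; edges $\{a_g^{1.1},a_g^{1.2}\},\{a_g^{1.2},a_g^{1.3}\},\{a_g^{1.3},a_g^{1.4}\},\{a_g^{1.4},a_g^{1.1}\}$. The graph $D_{G,S}$ is the (cubic, undirected) graph obtained from the disjoint union of all $A_g$, $g\in G$, and all $\mathfrak{C}_{[d,g,h]}$, one for each $d\in[k]$ and each edge $(g,h)$ of colour $d$ of $\mathrm{Cay}_{G,S}$, by adding for each such edge the four edges $\{a_g^{d.1},\mathfrak{C}_{[d,g,h]}(u_1)\}$,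 $\{a_g^{d.2},\mathfrak{C}_{[d,g,h]}(\ell_1)\}$, $\{\mathfrak{C}_{[d,g,h]}(6),a_h^{d.4}\}$, $\{\mathfrak{C}_{[d,g,h]}(9),a_h^{d.3}\}$. For an edge $(g,h)$ of colour $d$, the upper path from $a_g^{d.1}$ to $a_h^{d.4}$ is $a_g^{d.1},u_1,\dots,u_d,4,2,0,1,6,a_h^{d.4}$, and the lower path from $a_g^{d.2}$ to $a_h^{d.3}$ is $a_g^{d.2},\ell_1,\dots,\ell_d,7,8,9,a_h^{d.3}$ (labels in $\mathfrak{C}_{[d,g,h]}$). Roof edge cycle with starting point $g$: start at $a_g^{1.1}$ and take the upper path to $A_{gs_1}$; in general, having entered $A_h$ through the generator $s_d$ (i.e. at $a_h^{d.4}$), traverse the edge $\{a_h^{d.4},a_h^{d^+.1}\}$ and take the upper path from $a_h^{d^+.1}$ to $A_{hs_{d^+}}$; continue until a vertex is encountered for the second time. $H_{\mathrm{vis}}$ is the set of all $h\in G$ such that $A_h$ is entered via the last generator $s_k$ during this process. Base edge cycle with starting point $g$ and generator $s_d$: start at $a_g^{d.2}$ and take the lower path to $a_{gs_d}^{d.3}$; in general, having arrived at $a_h^{d.3}$ go on to $c_h^{d.1}$, then $a_h^{d.2}$ (if $k=1$, directly from $a_h^{1.3}$ to $a_h^{1.2}$), and then take the lower path to $a_{hs_d}^{d.3}$; continue until a vertex is encountered for the second time. $\bar H_{\mathrm{vis}}$ is the set of all group elements $h$ visited on the way. *)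

theory Defs
  imports "HOL-Algebra.Generated_Groups" "HOL-Library.Stream" "Graph_Theory.Digraph"
begin

text \<open>
  Throughout, \<open>G\<close> is a group and \<open>s 1, ..., s k\<close> are its generators in increasing order.
\<close>

definition cyc_succ :: "nat \<Rightarrow> nat \<Rightarrow> nat" where
  "cyc_succ k d = (if d < k then d + 1 else 1)"

primrec ordered_prod :: "('g, 'm) monoid_scheme \<Rightarrow> (nat \<Rightarrow> 'g) \<Rightarrow> nat \<Rightarrow> 'g" where
  "ordered_prod G s 0 = \<one>\<^bsub>G\<^esub>"
| "ordered_prod G s (Suc n) = ordered_prod G s n \<otimes>\<^bsub>G\<^esub> s (Suc n)"

text \<open>
  The arc \<open>(d, g, h)\<close> of the Cayley graph goes from \<open>g\<close> to \<open>h\<close> and has colour \<open>d\<close>.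
\<close>

definition cayley_graph ::
    "('g, 'm) monoid_scheme \<Rightarrow> (nat \<Rightarrow> 'g) \<Rightarrow> nat \<Rightarrow> ('g, nat \<times> 'g \<times> 'g) pre_digraph" where
  "cayley_graph G s k =
     \<lparr> verts = carrier G,
       arcs = {(d, g, g \<otimes>\<^bsub>G\<^esub> s d) | d g. d \<in> {1..k} \<and> g \<in> carrier G},
       tail = (\<lambda>(d, g, h). g),
       head = (\<lambda>(d, g, h). h) \<rparr>"


text \<open>Undirected graphs; an edge is the set of its two ends.\<close>

record 'v ugraph =
  uverts :: "'v set"
  uedges :: "'v set set"

text \<open>
  Chain labels: \<open>Upper i\<close> is $u_i$, \<open>Lower i\<close> is $l_i$ and \<open>Digit n\<close> is the label $n$.
\<close>

datatype label = Upper nat | Lower nat | Digit nat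

definition chain_labels :: "nat \<Rightarrow> label set" where
  "chain_labels d = Upper ` {1..d} \<union> Lower ` {1..d} \<union> Digit ` {0..9}"

definition chain_label_edges :: "nat \<Rightarrow> label set set" where
  "chain_label_edges d =
     {{Upper i, Upper (i + 1)} | i. 1 \<le> i \<and> i < d} \<union>
     {{Lower i, Lower (i + 1)} | i. 1 \<le> i \<and> i < d} \<union>
     {{Upper i, Lower i} | i. 1 \<le> i \<and> i \<le> d} \<union>
     {{Upper d, Digit 4}, {Lower d, Digit 7}} \<union>
     {{Digit 0, Digit 1}, {Digit 0, Digit 2}, {Digit 0, Digit 3}, {Digit 1, Digit 3},
      {Digit 1, Digit 6}, {Digit 2, Digit 4}, {Digit 2, Digit 5}, {Digit 3, Digit 5},
      {Digit 4, Digit 7}, {Digit 5, Digit 8}, {Digit 6, Digit 9}, {Digit 7, Digit 8},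
      {Digit 8, Digit 9}}"

text \<open>
  Vertices of $D_{G,S}$: \<open>A_vtx g d i\<close> is $a_g^{d.i}$, \<open>C_vtx g d i\<close> is $c_g^{d.i}$, and
  \<open>Chain_vtx d g h v\<close> is the vertex with label \<open>v\<close> of the chain of the arc \<open>(d, g, h)\<close>.
  Hence the blow-up graphs and the chains are automatically pairwise disjoint.
\<close>

datatype 'g vertex = A_vtx 'g nat nat | C_vtx 'g nat nat | Chain_vtx nat 'g 'g label

definition chain_graph :: "nat \<Rightarrow> 'g \<Rightarrow> 'g \<Rightarrow> 'g vertex ugraph" where
  "chain_graph d g h =
     \<lparr> uverts = Chain_vtx d g h ` chain_labels d,
       uedges = (\<lambda>e. Chain_vtx d g h ` e) ` chain_label_edges d \<rparr>"

definition blow_up_graph :: "nat \<Rightarrow> 'g \<Rightarrow> 'g vertex ugraph" where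
  "blow_up_graph k g =
    (if k = 1 then
       \<lparr> uverts = {A_vtx g 1 1, A_vtx g 1 2, A_vtx g 1 3, A_vtx g 1 4},
         uedges = {{A_vtx g 1 1, A_vtx g 1 2}, {A_vtx g 1 2, A_vtx g 1 3},
                   {A_vtx g 1 3, A_vtx g 1 4}, {A_vtx g 1 4, A_vtx g 1 1}} \<rparr>
     else if k = 2 then
       \<lparr> uverts = (\<Union>d\<in>{1..2}. {A_vtx g d 1, A_vtx g d 2, A_vtx g d 3, A_vtx g d 4,
                                C_vtx g d 1}),
         uedges = (\<Union>d\<in>{1..2}. {{A_vtx g d 1, A_vtx g d 2}, {A_vtx g d 2, C_vtx g d 1},
                                {C_vtx g d 1, A_vtx g d 3}, {A_vtx g d 3, A_vtx g d 4},
                                {A_vtx g d 4, A_vtx g (cyc_succ k d) 1}})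
                  \<union> {{C_vtx g 1 1, C_vtx g 2 1}} \<rparr>
     else
       \<lparr> uverts = (\<Union>d\<in>{1..k}. {A_vtx g d 1, A_vtx g d 2, A_vtx g d 3, A_vtx g d 4,
                                C_vtx g d 1, C_vtx g d 2}),
         uedges = (\<Union>d\<in>{1..k}. {{A_vtx g d 1, A_vtx g d 2}, {A_vtx g d 2, C_vtx g d 1},
                                {C_vtx g d 1, A_vtx g d 3}, {A_vtx g d 3, A_vtx g d 4},
                                {C_vtx g d 1, C_vtx g d 2},
                                {C_vtx g d 2, C_vtx g (cyc_succ k d) 2},
                                {A_vtx g d 4, A_vtx g (cyc_succ k d) 1}}) \<rparr>)"

definition D_graph :: "('g, 'm) monoid_scheme \<Rightarrow> (nat \<Rightarrow> 'g) \<Rightarrow> nat \<Rightarrow> 'g vertex ugraph" where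
  "D_graph G s k =
     \<lparr> uverts = (\<Union>g\<in>carrier G. uverts (blow_up_graph k g)) \<union>
                (\<Union>(d, g, h)\<in>arcs (cayley_graph G s k). uverts (chain_graph d g h)),
       uedges = (\<Union>g\<in>carrier G. uedges (blow_up_graph k g)) \<union>
                (\<Union>(d, g, h)\<in>arcs (cayley_graph G s k).
                   uedges (chain_graph d g h) \<union>
                   {{A_vtx g d 1, Chain_vtx d g h (Upper 1)},
                    {A_vtx g d 2, Chain_vtx d g h (Lower 1)},
                    {Chain_vtx d g h (Digit 6), A_vtx h d 4},
                    {Chain_vtx d g h (Digit 9), A_vtx h d 3}}) \<rparr>"


definition upper_path :: "nat \<Rightarrow> 'g \<Rightarrow> 'g \<Rightarrow> 'g vertex list" where
  "upper_path d g h =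
     A_vtx g d 1
     # map (Chain_vtx d g h)
         (map Upper [1..<Suc d] @ [Digit 4, Digit 2, Digit 0, Digit 1, Digit 6])
     @ [A_vtx h d 4]"

definition lower_path :: "nat \<Rightarrow> 'g \<Rightarrow> 'g \<Rightarrow> 'g vertex list" where
  "lower_path d g h =
     A_vtx g d 2
     # map (Chain_vtx d g h) (map Lower [1..<Suc d] @ [Digit 7, Digit 8, Digit 9])
     @ [A_vtx h d 3]"

text \<open>
  Both cycles are computed by following an infinite walk until a vertex is encountered for the
  second time; that second occurrence is kept as the last entry of the list.
\<close>

definition until_repetition :: "'v stream \<Rightarrow> 'v list" where
  "until_repetition w = stake (Suc (LEAST n. \<exists>m<n. w !! m = w !! n)) w"

text \<open>
  The pair \<open>(h, d)\<close> stands for the upper path that leaves the blow-up graph of \<open>h\<close> along \<open>s d\<close>.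
  The next path starts at the neighbour \<open>A_vtx (h s_d) (cyc_succ k d) 1\<close> of its last vertex.
\<close>

definition roof_walk ::
    "('g, 'm) monoid_scheme \<Rightarrow> (nat \<Rightarrow> 'g) \<Rightarrow> nat \<Rightarrow> 'g \<Rightarrow> 'g vertex stream" where
  "roof_walk G s k g =
     flat (smap (\<lambda>(h, d). upper_path d h (h \<otimes>\<^bsub>G\<^esub> s d))
             (siterate (\<lambda>(h, d). (h \<otimes>\<^bsub>G\<^esub> s d, cyc_succ k d)) (g, 1)))"

definition roof_edge_cycle ::
    "('g, 'm) monoid_scheme \<Rightarrow> (nat \<Rightarrow> 'g) \<Rightarrow> nat \<Rightarrow> 'g \<Rightarrow> 'g vertex list" where
  "roof_edge_cycle G s k g = until_repetition (roof_walk G s k g)"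

text \<open>A blow-up graph is entered through the generator \<open>s d\<close> precisely at its vertex $a^{d.4}$.\<close>

definition H_vis :: "('g, 'm) monoid_scheme \<Rightarrow> (nat \<Rightarrow> 'g) \<Rightarrow> nat \<Rightarrow> 'g \<Rightarrow> 'g set" where
  "H_vis G s k g = {h \<in> carrier G. A_vtx h k 4 \<in> set (roof_edge_cycle G s k g)}"

definition base_walk ::
    "('g, 'm) monoid_scheme \<Rightarrow> (nat \<Rightarrow> 'g) \<Rightarrow> nat \<Rightarrow> nat \<Rightarrow> 'g \<Rightarrow> 'g vertex stream" where
  "base_walk G s k d g =
     flat (smap (\<lambda>h. lower_path d h (h \<otimes>\<^bsub>G\<^esub> s d)
                       @ (if k = 1 then [] else [C_vtx (h \<otimes>\<^bsub>G\<^esub> s d) d 1]))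
             (siterate (\<lambda>h. h \<otimes>\<^bsub>G\<^esub> s d) g))"

definition base_edge_cycle ::
    "('g, 'm) monoid_scheme \<Rightarrow> (nat \<Rightarrow> 'g) \<Rightarrow> nat \<Rightarrow> nat \<Rightarrow> 'g \<Rightarrow> 'g vertex list" where
  "base_edge_cycle G s k d g = until_repetition (base_walk G s k d g)"

text \<open>A group element is visited if its blow-up graph is.\<close>

definition H_vis_bar ::
    "('g, 'm) monoid_scheme \<Rightarrow> (nat \<Rightarrow> 'g) \<Rightarrow> nat \<Rightarrow> nat \<Rightarrow> 'g \<Rightarrow> 'g set" where
  "H_vis_bar G s k d g =
     {h \<in> carrier G. set (base_edge_cycle G s k d g) \<inter> uverts (blow_up_graph k h) \<noteq> {}}"


text \<open>Both walks are walks in \<open>D_graph\<close>.\<close>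

lemma flat_adjacent:
  assumes "\<And>n. ss !! n \<noteq> []" and "\<And>n. successively P (ss !! n)"
    and "\<And>n. P (last (ss !! n)) (hd (ss !! Suc n))"
  shows "P (flat ss !! i) (flat ss !! Suc i)"
  using assms
proof (induction i arbitrary: ss)
  case (0 ss)
  then show ?case
    using "0.prems"(1)[of 0] "0.prems"(2)[of 0] "0.prems"(3)[of 0] "0.prems"(1)[of 1]
    by (cases "shd ss"; cases "tl (shd ss)") auto
next
  case (Suc i ss)
  let ?ss = "if tl (shd ss) = [] then stl ss else tl (shd ss) ## stl ss"
  have nonempty: "?ss !! n \<noteq> []" for n
    using Suc.prems(1)[of n] Suc.prems(1)[of "Suc n"] by (cases n) auto
  have "shd ss \<noteq> []" using Suc.prems(1)[of 0] by simp
  moreover have "successively P (shd ss)" using Suc.prems(2)[of 0] by simp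
  ultimately have "successively P (tl (shd ss))"
    by (metis list.collapse successively_Cons successively.simps(1))
  then have succ: "successively P (?ss !! n)" for n
    using Suc.prems(2)[of n] Suc.prems(2)[of "Suc n"] by (cases n) auto
  have "P (last (?ss !! n)) (hd (?ss !! Suc n))" for n
    using Suc.prems(3)[of n] Suc.prems(3)[of "Suc n"] by (cases n) (auto simp: last_tl)
  from Suc.IH[OF nonempty succ this] show ?case by simp
qed

lemma successively_chain_part:
  assumes "successively Q xs" and "\<And>x y. Q x y \<Longrightarrow> P (f x) (f y)"
  shows "successively P (map f xs)"
  using assms by (auto simp: successively_map elim: successively_mono)

lemma successively_labels:
  assumes "\<And>i. m \<le> i \<Longrightarrow> Suc i < n \<Longrightarrow> Q (f i) (f (Suc i))"
  shows "successively Q (map f [m..<n])"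
  using assms by (auto simp: successively_conv_nth)

lemma chain_label_edges_simps:
  "1 \<le> i \<Longrightarrow> i < d \<Longrightarrow> {Upper i, Upper (Suc i)} \<in> chain_label_edges d"
  "1 \<le> i \<Longrightarrow> i < d \<Longrightarrow> {Lower i, Lower (Suc i)} \<in> chain_label_edges d"
  "{Upper d, Digit 4} \<in> chain_label_edges d"
  "{Digit 4, Digit 2} \<in> chain_label_edges d"
  "{Digit 2, Digit 0} \<in> chain_label_edges d"
  "{Digit 0, Digit 1} \<in> chain_label_edges d"
  "{Digit 1, Digit 6} \<in> chain_label_edges d"
  "{Lower d, Digit 7} \<in> chain_label_edges d"
  "{Digit 7, Digit 8} \<in> chain_label_edges d"
  "{Digit 8, Digit 9} \<in> chain_label_edges d"
  by (simp_all add: chain_label_edges_def doubleton_eq_iff) auto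

lemma arcs_cayley_graph:
  "(d, g, h) \<in> arcs (cayley_graph G s k)
     \<longleftrightarrow> d \<in> {1..k} \<and> g \<in> carrier G \<and> h = g \<otimes>\<^bsub>G\<^esub> s d"
  by (auto simp: cayley_graph_def)

lemma uedges_D_graph_chain:
  assumes "(d, g, h) \<in> arcs (cayley_graph G s k)" and "{x, y} \<in> chain_label_edges d"
  shows "{Chain_vtx d g h x, Chain_vtx d g h y} \<in> uedges (D_graph G s k)"
proof -
  have "Chain_vtx d g h ` {x, y} \<in> uedges (chain_graph d g h)"
    unfolding chain_graph_def using assms(2) by (simp only: ugraph.simps) (rule imageI)
  then show ?thesis using assms(1) by (force simp: D_graph_def)
qed

lemma uedges_D_graph_connect:
  assumes "(d, g, h) \<in> arcs (cayley_graph G s k)"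
  shows "{A_vtx g d 1, Chain_vtx d g h (Upper 1)} \<in> uedges (D_graph G s k)"
    and "{A_vtx g d 2, Chain_vtx d g h (Lower 1)} \<in> uedges (D_graph G s k)"
    and "{Chain_vtx d g h (Digit 6), A_vtx h d 4} \<in> uedges (D_graph G s k)"
    and "{Chain_vtx d g h (Digit 9), A_vtx h d 3} \<in> uedges (D_graph G s k)"
  unfolding D_graph_def using assms by force+

lemma uedges_D_graph_blow_up:
  assumes "g \<in> carrier G" and "e \<in> uedges (blow_up_graph k g)"
  shows "e \<in> uedges (D_graph G s k)"
  using assms by (auto simp: D_graph_def)

lemma blow_up_graph_edges:
  assumes "d \<in> {1..k}"
  shows "{A_vtx h d 4, A_vtx h (cyc_succ k d) 1} \<in> uedges (blow_up_graph k h)"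
    and "k = 1 \<Longrightarrow> {A_vtx h d 3, A_vtx h d 2} \<in> uedges (blow_up_graph k h)"
    and "k \<noteq> 1 \<Longrightarrow> {A_vtx h d 3, C_vtx h d 1} \<in> uedges (blow_up_graph k h)"
    and "k \<noteq> 1 \<Longrightarrow> {C_vtx h d 1, A_vtx h d 2} \<in> uedges (blow_up_graph k h)"
proof -
  have "(\<Union>d\<in>{1..k}. {{A_vtx h d 2, C_vtx h d 1}, {C_vtx h d 1, A_vtx h d 3},
                     {A_vtx h d 4, A_vtx h (cyc_succ k d) 1}})
          \<subseteq> uedges (blow_up_graph k h)" if "k \<noteq> 1"
  proof (cases "k = 2")
    case True
    then have k: "{1..k} = {1..2}" by simp
    show ?thesis
      unfolding blow_up_graph_def if_not_P[OF that] if_P[OF True] ugraph.simps k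
      by (intro le_supI1 UN_mono order_refl) simp
  next
    case False
    show ?thesis
      unfolding blow_up_graph_def if_not_P[OF that] if_not_P[OF False] ugraph.simps
      by (intro UN_mono order_refl) simp
  qed
  moreover have "{A_vtx h d 2, C_vtx h d 1} \<in> (\<Union>d\<in>{1..k}. {{A_vtx h d 2, C_vtx h d 1},
      {C_vtx h d 1, A_vtx h d 3}, {A_vtx h d 4, A_vtx h (cyc_succ k d) 1}})"
    and "{C_vtx h d 1, A_vtx h d 3} \<in> (\<Union>d\<in>{1..k}. {{A_vtx h d 2, C_vtx h d 1},
      {C_vtx h d 1, A_vtx h d 3}, {A_vtx h d 4, A_vtx h (cyc_succ k d) 1}})"
    and "{A_vtx h d 4, A_vtx h (cyc_succ k d) 1} \<in> (\<Union>d\<in>{1..k}. {{A_vtx h d 2, C_vtx h d 1},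
      {C_vtx h d 1, A_vtx h d 3}, {A_vtx h d 4, A_vtx h (cyc_succ k d) 1}})"
    by (rule UN_I[OF assms], simp)+
  ultimately have big: "k \<noteq> 1 \<Longrightarrow> {A_vtx h d 2, C_vtx h d 1} \<in> uedges (blow_up_graph k h)"
    "k \<noteq> 1 \<Longrightarrow> {C_vtx h d 1, A_vtx h d 3} \<in> uedges (blow_up_graph k h)"
    "k \<noteq> 1 \<Longrightarrow> {A_vtx h d 4, A_vtx h (cyc_succ k d) 1} \<in> uedges (blow_up_graph k h)"
    by (meson subsetD)+
  have small: "{A_vtx h d 4, A_vtx h (cyc_succ k d) 1} \<in> uedges (blow_up_graph k h)"
    "{A_vtx h d 3, A_vtx h d 2} \<in> uedges (blow_up_graph k h)" if "k = 1"
    using that assms by (simp_all add: blow_up_graph_def cyc_succ_def doubleton_eq_iff)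
  show "{A_vtx h d 4, A_vtx h (cyc_succ k d) 1} \<in> uedges (blow_up_graph k h)"
    using big(3) small(1) by (cases "k = 1")
  show "k = 1 \<Longrightarrow> {A_vtx h d 3, A_vtx h d 2} \<in> uedges (blow_up_graph k h)"
    by (rule small(2))
  show "k \<noteq> 1 \<Longrightarrow> {A_vtx h d 3, C_vtx h d 1} \<in> uedges (blow_up_graph k h)"
    by (subst insert_commute) (rule big(2))
  show "k \<noteq> 1 \<Longrightarrow> {C_vtx h d 1, A_vtx h d 2} \<in> uedges (blow_up_graph k h)"
    by (subst insert_commute) (rule big(1))
qed

lemma upper_path_in_D_graph:
  assumes "(d, g, h) \<in> arcs (cayley_graph G s k)"
  shows "successively (\<lambda>x y. {x, y} \<in> uedges (D_graph G s k)) (upper_path d g h)"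
proof -
  let ?P = "\<lambda>x y. {x, y} \<in> uedges (D_graph G s k)"
  let ?xs = "map Upper [1..<Suc d] @ [Digit 4, Digit 2, Digit 0, Digit 1, Digit 6]"
  have d: "1 \<le> d" using assms by (simp add: arcs_cayley_graph)
  have "successively (\<lambda>x y. {x, y} \<in> chain_label_edges d) (map Upper [1..<Suc d])"
    by (rule successively_labels) (simp add: chain_label_edges_simps)
  then have "successively (\<lambda>x y. {x, y} \<in> chain_label_edges d) ?xs"
    using d by (simp add: successively_append_iff chain_label_edges_simps
        chain_label_edges_simps(6,7)[unfolded One_nat_def])
  then have "successively ?P (map (Chain_vtx d g h) ?xs)"
    by (rule successively_chain_part) (rule uedges_D_graph_chain[OF assms])
  moreover have "hd (map (Chain_vtx d g h) ?xs) = Chain_vtx d g h (Upper 1)"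
    using d by (simp add: hd_append hd_map upt_conv_Cons del: upt_Suc)
  moreover have "last (map (Chain_vtx d g h) ?xs) = Chain_vtx d g h (Digit 6)" by simp
  ultimately show ?thesis
    unfolding upper_path_def using uedges_D_graph_connect[OF assms]
    by (simp add: successively_Cons successively_append_iff hd_append del: map_append upt_Suc)
qed

lemma lower_path_in_D_graph:
  assumes "(d, g, h) \<in> arcs (cayley_graph G s k)"
  shows "successively (\<lambda>x y. {x, y} \<in> uedges (D_graph G s k)) (lower_path d g h)"
proof -
  let ?P = "\<lambda>x y. {x, y} \<in> uedges (D_graph G s k)"
  let ?xs = "map Lower [1..<Suc d] @ [Digit 7, Digit 8, Digit 9]"
  have d: "1 \<le> d" using assms by (simp add: arcs_cayley_graph)
  have "successively (\<lambda>x y. {x, y} \<in> chain_label_edges d) (map Lower [1..<Suc d])"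
    by (rule successively_labels) (simp add: chain_label_edges_simps)
  then have "successively (\<lambda>x y. {x, y} \<in> chain_label_edges d) ?xs"
    using d by (simp add: successively_append_iff chain_label_edges_simps
        chain_label_edges_simps(6,7)[unfolded One_nat_def])
  then have "successively ?P (map (Chain_vtx d g h) ?xs)"
    by (rule successively_chain_part) (rule uedges_D_graph_chain[OF assms])
  moreover have "hd (map (Chain_vtx d g h) ?xs) = Chain_vtx d g h (Lower 1)"
    using d by (simp add: hd_append hd_map upt_conv_Cons del: upt_Suc)
  moreover have "last (map (Chain_vtx d g h) ?xs) = Chain_vtx d g h (Digit 9)" by simp
  ultimately show ?thesis
    unfolding lower_path_def using uedges_D_graph_connect[OF assms]
    by (simp add: successively_Cons successively_append_iff hd_append del: map_append upt_Suc)
qed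

lemma roof_walk_in_D_graph:
  assumes "group G" and "s ` {1..k} \<subseteq> carrier G" and "1 \<le> k" and "g \<in> carrier G"
  shows "{roof_walk G s k g !! i, roof_walk G s k g !! Suc i} \<in> uedges (D_graph G s k)"
proof -
  interpret group G by fact
  define st where
    "st = (\<lambda>n. ((\<lambda>(h, d). (h \<otimes>\<^bsub>G\<^esub> s d, cyc_succ k d)) ^^ n) (g, 1 :: nat))"
  have st: "fst (st n) \<in> carrier G \<and> snd (st n) \<in> {1..k}" for n
  proof (induction n)
    case (Suc n)
    then have "s (snd (st n)) \<in> carrier G" using assms(2) by blast
    with Suc show ?case using assms(3) by (auto simp: st_def cyc_succ_def split: prod.splits)
  qed (use assms in \<open>auto simp: st_def\<close>)
  have Suc: "st (Suc n) = (fst (st n) \<otimes>\<^bsub>G\<^esub> s (snd (st n)), cyc_succ k (snd (st n)))" for n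
    by (simp add: st_def case_prod_beta)
  have "{A_vtx (fst (st (Suc n))) (snd (st n)) 4, A_vtx (fst (st (Suc n))) (snd (st (Suc n))) 1}
               \<in> uedges (D_graph G s k)" for n
    using uedges_D_graph_blow_up[OF conjunct1[OF st[of "Suc n"]]
        blow_up_graph_edges(1)[OF conjunct2[OF st[of n]]]]
    by (simp add: Suc)
  moreover have "successively (\<lambda>x y. {x, y} \<in> uedges (D_graph G s k))
      (upper_path (snd (st n)) (fst (st n)) (fst (st (Suc n))))" for n
    by (rule upper_path_in_D_graph) (use st[of n] in \<open>auto simp: arcs_cayley_graph Suc\<close>)
  moreover have "smap (\<lambda>(h, d). upper_path d h (h \<otimes>\<^bsub>G\<^esub> s d))
      (siterate (\<lambda>(h, d). (h \<otimes>\<^bsub>G\<^esub> s d, cyc_succ k d)) (g, 1)) !! n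
    = upper_path (snd (st n)) (fst (st n)) (fst (st (Suc n)))" for n
    unfolding snth_smap snth_siterate Suc by (simp add: st_def case_prod_beta)
  moreover have "last (upper_path d x y) = A_vtx y d 4" "hd (upper_path d x y) = A_vtx x d 1"
    "upper_path d x y \<noteq> []" for d and x y :: 'a
    by (simp_all add: upper_path_def)
  ultimately show ?thesis
    unfolding roof_walk_def
    by (intro flat_adjacent[where P = "\<lambda>x y. {x, y} \<in> uedges (D_graph G s k)"])
      (simp_all del: snth.simps snth_smap snth_siterate)
qed

lemma base_walk_in_D_graph:
  assumes "group G" and "s ` {1..k} \<subseteq> carrier G" and "d \<in> {1..k}" and "g \<in> carrier G"
  shows "{base_walk G s k d g !! i, base_walk G s k d g !! Suc i} \<in> uedges (D_graph G s k)"
proof -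
  interpret group G by fact
  define st where "st = (\<lambda>n. ((\<lambda>h. h \<otimes>\<^bsub>G\<^esub> s d) ^^ n) g)"
  have "s d \<in> carrier G" using assms(2,3) by blast
  then have st: "st n \<in> carrier G" for n
    using assms(4) by (induction n) (auto simp: st_def)
  have Suc: "st (Suc n) = st n \<otimes>\<^bsub>G\<^esub> s d" for n by (simp add: st_def)
  have lower: "successively (\<lambda>x y. {x, y} \<in> uedges (D_graph G s k))
      (lower_path d (st n) (st (Suc n)))" for n
    by (rule lower_path_in_D_graph) (use st[of n] assms(3) in \<open>auto simp: arcs_cayley_graph Suc\<close>)
  have "k = 1 \<Longrightarrow> {A_vtx (st n) d 3, A_vtx (st n) d 2} \<in> uedges (D_graph G s k)"
    and "k \<noteq> 1 \<Longrightarrow> {A_vtx (st n) d 3, C_vtx (st n) d 1} \<in> uedges (D_graph G s k)"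
    and "k \<noteq> 1 \<Longrightarrow> {C_vtx (st n) d 1, A_vtx (st n) d 2} \<in> uedges (D_graph G s k)" for n
    by (rule uedges_D_graph_blow_up[OF st blow_up_graph_edges(2)[OF assms(3)]]
          uedges_D_graph_blow_up[OF st blow_up_graph_edges(3)[OF assms(3)]]
          uedges_D_graph_blow_up[OF st blow_up_graph_edges(4)[OF assms(3)]], assumption)+
  moreover have "last (lower_path d x y) = A_vtx y d 3" "hd (lower_path d x y) = A_vtx x d 2"
    "lower_path d x y \<noteq> []" for x y :: 'a
    by (simp_all add: lower_path_def)
  moreover have "smap (\<lambda>h. lower_path d h (h \<otimes>\<^bsub>G\<^esub> s d)
        @ (if k = 1 then [] else [C_vtx (h \<otimes>\<^bsub>G\<^esub> s d) d 1]))
      (siterate (\<lambda>h. h \<otimes>\<^bsub>G\<^esub> s d) g) !! n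
    = lower_path d (st n) (st (Suc n)) @ (if k = 1 then [] else [C_vtx (st (Suc n)) d 1])" for n
    unfolding snth_smap snth_siterate Suc by (simp add: st_def)
  ultimately show ?thesis
    unfolding base_walk_def using lower
    by (intro flat_adjacent[where P = "\<lambda>x y. {x, y} \<in> uedges (D_graph G s k)"])
      (simp_all add: successively_append_iff
         del: snth.simps snth_smap snth_siterate)
qed

end

theory Submission
  imports Defs "HOL-Algebra.Multiplicative_Group"
begin

text \<open>
  On each walk every vertex determines the next one, so the vertices met before the first
  repetition are already all vertices of the infinite walk. What the infinite walk visits is read
  off its blocks: the roof walk leaves, after \<open>n\<close> upper paths, the blow-up graph of
  $g s^{n\,\mathrm{div}\,k} s_1 \cdots s_{n \bmod k}$, and the base walk, after \<open>n\<close> lower paths,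
  that of $g s_d^n$. As the group is finite, the powers with natural exponents form the generated
  subgroup.
\<close>

section \<open>Deterministic walks and the successor maps of the two walks\<close>

lemma set_until_repetition:
  assumes step: "\<And>n. w !! Suc n = f (w !! n)" and "finite (sset w)"
  shows "set (until_repetition w) = sset w"
proof -
  define N where "N = (LEAST n. \<exists>m<n. w !! m = w !! n)"
  have "\<not> inj (snth w)"
    using assms(2) finite_imageD[of "snth w" UNIV] by (auto simp: sset_range)
  then have "\<exists>n. \<exists>m<n. w !! m = w !! n"
    by (metis injI nat_neq_iff)
  then obtain m where m: "m < N" "w !! m = w !! N"
    unfolding N_def using LeastI_ex[of "\<lambda>n. \<exists>m<n. w !! m = w !! n"] by blast
  \<comment> \<open>Indices below \<open>N\<close> suffice: a step that would reach index
    \<open>N\<close> lands on the equal vertex at index \<open>m\<close>. Nothing forces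
    \<open>m\<close> to be 0, so the walk may close at a vertex other than its first.\<close>
  have "\<exists>j<N. w !! i = w !! j" for i
  proof (induction i)
    case 0
    then show ?case using m(1) by (intro exI[of _ 0]) auto
  next
    case (Suc i)
    then obtain j where j: "j < N" "w !! i = w !! j" by blast
    then have "w !! Suc i = w !! Suc j" by (simp only: step)
    moreover have "Suc j < N \<or> Suc j = N" using j(1) by linarith
    ultimately show ?case using m by metis
  qed
  then have "sset w \<subseteq> set (stake (Suc N) w)"
    unfolding sset_range in_set_conv_nth subset_iff by (metis rangeE less_SucI length_stake stake_nth)
  moreover have "set (stake (Suc N) w) \<subseteq> sset w"
    by (auto simp: sset_range in_set_conv_nth simp del: stake.simps)
  ultimately show ?thesis
    unfolding until_repetition_def N_def by blast
qed

text \<open>Determinism need only be checked inside blocks and at the seams between them, and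
  finitely many distinct blocks contain finitely many vertices.\<close>

lemma set_until_repetition_flat:
  assumes "\<And>n. ss !! n \<noteq> []" and "\<And>n. successively (\<lambda>x y. y = f x) (ss !! n)"
    and "\<And>n. hd (ss !! Suc n) = f (last (ss !! n))"
    and "finite (sset ss)"
  shows "set (until_repetition (flat ss)) = (\<Union>n. set (ss !! n))"
proof -
  have sset: "sset (flat ss) = (\<Union>n. set (ss !! n))"
    using assms(1) by (subst sset_flat) (auto simp: sset_range)
  have "\<forall>xs\<in>sset ss. xs \<noteq> []"
    using assms(1) by (simp add: sset_range)
  then have "finite (sset (flat ss))"
    using assms(4) by simp
  moreover have "flat ss !! Suc i = f (flat ss !! i)" for i
    using assms(1-3) by (rule flat_adjacent)
  ultimately show ?thesis
    using set_until_repetition sset by metis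
qed

text \<open>A chain vertex carries its colour and both ends of its arc, and
  \<open>A_vtx h d 1\<close> fixes the path that leaves it, so a vertex alone determines its
  successor. Index 4 of \<open>A_vtx\<close> and \<open>Digit 1\<close> are covered by the final
  branches; off the upper paths the values are arbitrary.\<close>

definition roof_next ::
    "('g, 'm) monoid_scheme \<Rightarrow> (nat \<Rightarrow> 'g) \<Rightarrow> nat \<Rightarrow> 'g vertex \<Rightarrow> 'g vertex" where
  "roof_next G s k v = (case v of
     A_vtx h d i \<Rightarrow> if i = 1 then Chain_vtx d h (h \<otimes>\<^bsub>G\<^esub> s d) (Upper 1)
                   else A_vtx h (cyc_succ k d) 1
   | C_vtx h d i \<Rightarrow> v
   | Chain_vtx d g h l \<Rightarrow> (case l of
       Upper i \<Rightarrow> Chain_vtx d g h (if i < d then Upper (Suc i) else Digit 4)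
     | Lower i \<Rightarrow> v
     | Digit n \<Rightarrow> if n = 6 then A_vtx h d 4
                 else Chain_vtx d g h (Digit (if n = 4 then 2 else if n = 2 then 0
                                              else if n = 0 then 1 else 6))))"

text \<open>\<open>Suc\<close> works because the digits 7, 8, 9 of a lower path are consecutive. For
  \<open>k = 1\<close> the blow-up graph has no centre vertex to pass through.\<close>

definition base_next ::
    "('g, 'm) monoid_scheme \<Rightarrow> (nat \<Rightarrow> 'g) \<Rightarrow> nat \<Rightarrow> 'g vertex \<Rightarrow> 'g vertex" where
  "base_next G s k v = (case v of
     A_vtx h d i \<Rightarrow> if i = 2 then Chain_vtx d h (h \<otimes>\<^bsub>G\<^esub> s d) (Lower 1)
                   else if k = 1 then A_vtx h d 2 else C_vtx h d 1
   | C_vtx h d i \<Rightarrow> A_vtx h d 2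
   | Chain_vtx d g h l \<Rightarrow> (case l of
       Upper i \<Rightarrow> v
     | Lower i \<Rightarrow> Chain_vtx d g h (if i < d then Lower (Suc i) else Digit 7)
     | Digit n \<Rightarrow> if n = 9 then A_vtx h d 3 else Chain_vtx d g h (Digit (Suc n))))"

lemma successively_upper_path:
  assumes "1 \<le> d"
  shows "successively (\<lambda>x y. y = roof_next G s k x) (upper_path d h (h \<otimes>\<^bsub>G\<^esub> s d))"
proof -
  let ?P = "\<lambda>x y. y = roof_next G s k x"
  \<comment> \<open>Only the run of \<open>Upper\<close> labels has variable length. Once its ends
    are known, the rest of the path is an explicit list.\<close>
  define xs where "xs = map (\<lambda>i. Chain_vtx d h (h \<otimes>\<^bsub>G\<^esub> s d) (Upper i)) [1..<Suc d]"
  have "successively ?P xs"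
    unfolding xs_def by (rule successively_labels) (simp add: roof_next_def)
  moreover have "xs \<noteq> []" "hd xs = Chain_vtx d h (h \<otimes>\<^bsub>G\<^esub> s d) (Upper 1)"
    "last xs = Chain_vtx d h (h \<otimes>\<^bsub>G\<^esub> s d) (Upper d)"
    using assms by (simp_all add: xs_def hd_map last_map del: upt_Suc)
  ultimately show ?thesis
    unfolding upper_path_def map_append map_map comp_def xs_def[symmetric]
    by (simp add: successively_Cons successively_append_iff roof_next_def)
qed

lemma successively_lower_path:
  assumes "1 \<le> d"
  shows "successively (\<lambda>x y. y = base_next G s k x) (lower_path d h (h \<otimes>\<^bsub>G\<^esub> s d))"
proof -
  let ?P = "\<lambda>x y. y = base_next G s k x"
  define xs where "xs = map (\<lambda>i. Chain_vtx d h (h \<otimes>\<^bsub>G\<^esub> s d) (Lower i)) [1..<Suc d]"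
  have "successively ?P xs"
    unfolding xs_def by (rule successively_labels) (simp add: base_next_def)
  moreover have "xs \<noteq> []" "hd xs = Chain_vtx d h (h \<otimes>\<^bsub>G\<^esub> s d) (Lower 1)"
    "last xs = Chain_vtx d h (h \<otimes>\<^bsub>G\<^esub> s d) (Lower d)"
    using assms by (simp_all add: xs_def hd_map last_map del: upt_Suc)
  ultimately show ?thesis
    unfolding lower_path_def map_append map_map comp_def xs_def[symmetric]
    by (simp add: successively_Cons successively_append_iff base_next_def)
qed

section \<open>Blow-up graphs met by the paths\<close>

lemma path_ends:
  "upper_path d g h \<noteq> []" "hd (upper_path d g h) = A_vtx g d 1"
  "last (upper_path d g h) = A_vtx h d 4"
  "lower_path d g h \<noteq> []" "hd (lower_path d g h) = A_vtx g d 2"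
  "last (lower_path d g h) = A_vtx h d 3"
  by (simp_all add: upper_path_def lower_path_def)

text \<open>Makes index 4 with colour \<open>k\<close> detect exactly the entries through the last
  generator.\<close>

lemma A_vtx_in_upper_path:
  "A_vtx x e i \<in> set (upper_path d g h)
     \<longleftrightarrow> e = d \<and> (x = g \<and> i = 1 \<or> x = h \<and> i = 4)"
  by (auto simp: upper_path_def)

text \<open>Lets the visited group elements be read off from the \<open>A_vtx\<close> and
  \<open>C_vtx\<close> entries of a walk.\<close>

lemma blow_up_graph_owner:
  shows "Chain_vtx d g h l \<notin> uverts (blow_up_graph k x)"
    and "A_vtx h d i \<in> uverts (blow_up_graph k x) \<Longrightarrow> x = h"
    and "C_vtx h d i \<in> uverts (blow_up_graph k x) \<Longrightarrow> x = h"
  by (auto simp: blow_up_graph_def split: if_splits)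

lemma A_vtx_in_blow_up_graph:
  "d \<in> {1..k} \<Longrightarrow> A_vtx h d 2 \<in> uverts (blow_up_graph k h)"
  by (auto simp: blow_up_graph_def)

section \<open>Cyclic subgroups and the group elements reached by the walks\<close>

context group
begin

lemma ordered_prod_closed:
  "s ` {1..k} \<subseteq> carrier G \<Longrightarrow> n \<le> k \<Longrightarrow> ordered_prod G s n \<in> carrier G"
  by (induction n) (auto simp: image_subset_iff)

lemma generate_singleton_finite:
  assumes "finite (carrier G)" and "a \<in> carrier G"
  shows "generate G {a} = range (\<lambda>n :: nat. a [^] n)"
  using generate_pow_on_finite_carrier[OF assms] by auto

text \<open>As \<open>a [^] order G\<close> is the identity, every exponent can be raised by
  \<open>order G\<close>. Positive exponents are what the roof walk yields: it completes a round
  before first entering through the last generator.\<close>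

lemma generate_singleton_finite_pos:
  assumes "finite (carrier G)" and "a \<in> carrier G"
  shows "generate G {a} = range (\<lambda>n :: nat. a [^] Suc n)"
proof -
  have "a [^] n = a [^] Suc (n + (order G - 1))" for n :: nat
    using assms order_gt_0_iff_finite pow_order_eq_1
    by (simp add: nat_pow_mult[symmetric] del: nat_pow_Suc flip: add_Suc_right)
  then show ?thesis
    unfolding generate_singleton_finite[OF assms] by blast
qed

text \<open>The colours cycle through 1 to \<open>k\<close>, so each full round contributes the
  whole ordered product and an unfinished round a partial one. The colour exceeds the remainder by
  one because the walk starts with colour 1.\<close>

lemma roof_state:
  assumes "s ` {1..k} \<subseteq> carrier G" and "1 \<le> k" and "g \<in> carrier G"
  shows "((\<lambda>(h, d). (h \<otimes> s d, cyc_succ k d)) ^^ n) (g, 1) =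
    (g \<otimes> (ordered_prod G s k [^] (n div k) \<otimes> ordered_prod G s (n mod k)), Suc (n mod k))"
proof (induction n)
  case 0
  then show ?case using assms by simp
next
  case (Suc n)
  have "n mod k < k" using assms(2) by simp
  then have cl: "ordered_prod G s k \<in> carrier G" "ordered_prod G s (n mod k) \<in> carrier G"
    "s (Suc (n mod k)) \<in> carrier G"
    using assms(1) ordered_prod_closed[OF assms(1)] by (auto simp: image_subset_iff)
  have step: "((\<lambda>(h, d). (h \<otimes> s d, cyc_succ k d)) ^^ Suc n) (g, 1) =
    (g \<otimes> (ordered_prod G s k [^] (n div k) \<otimes> ordered_prod G s (n mod k)) \<otimes> s (Suc (n mod k)),
     cyc_succ k (Suc (n mod k)))"
    by (simp only: funpow.simps comp_apply Suc prod.case)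
  show ?case
  proof (cases "Suc (n mod k) = k")
    case True
    \<comment> \<open>The last factor of a round completes the partial product to one more copy of
      the full product.\<close>
    then have "ordered_prod G s (n mod k) \<otimes> s (Suc (n mod k)) = ordered_prod G s k"
      by (metis ordered_prod.simps(2))
    with True cl assms(3) show ?thesis
      unfolding step by (simp add: cyc_succ_def mod_Suc div_Suc m_assoc)
  next
    case False
    with \<open>n mod k < k\<close> cl assms(3) show ?thesis
      unfolding step by (simp add: cyc_succ_def mod_Suc div_Suc m_assoc)
  qed
qed

lemma base_state:
  assumes "a \<in> carrier G" and "g \<in> carrier G"
  shows "((\<lambda>h. h \<otimes> a) ^^ n) g = g \<otimes> a [^] n"
  using assms by (induction n) (simp_all add: m_assoc)

section \<open>The visited sets as cosets\<close>

lemma H_vis_eq: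
  assumes "finite (carrier G)" and "s ` {1..k} \<subseteq> carrier G" and "1 \<le> k" and "g \<in> carrier G"
  shows "H_vis G s k g = g <# generate G {ordered_prod G s k}"
proof -
  define st where "st n = ((\<lambda>(h, d). (h \<otimes> s d, cyc_succ k d)) ^^ n) (g, 1 :: nat)" for n
  let ?p = "ordered_prod G s"
  let ?ss = "smap (\<lambda>(h, d). upper_path d h (h \<otimes> s d))
    (siterate (\<lambda>(h, d). (h \<otimes> s d, cyc_succ k d)) (g, 1))"
  have p: "?p k \<in> carrier G" using ordered_prod_closed[OF assms(2)] by simp
  have st_eq: "st n = (g \<otimes> (?p k [^] (n div k) \<otimes> ?p (n mod k)), Suc (n mod k))" for n
    unfolding st_def by (rule roof_state[OF assms(2-4)])
  have snth: "?ss !! n = upper_path (snd (st n)) (fst (st n)) (fst (st n) \<otimes> s (snd (st n)))" for n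
    by (simp add: st_def case_prod_beta)
  have Suc: "st (Suc n) = (fst (st n) \<otimes> s (snd (st n)), cyc_succ k (snd (st n)))" for n
    by (simp add: st_def case_prod_beta)
  have st: "st n \<in> carrier G \<times> {1..k}" for n
    using assms(3,4) p ordered_prod_closed[OF assms(2), of "n mod k"] mod_less_divisor[of k n]
    by (auto simp: st_eq Suc_le_eq less_imp_le)
  \<comment> \<open>The states lie in a finite set, so the infinite walk has only finitely many
    distinct blocks.\<close>
  have "range st \<subseteq> carrier G \<times> {1..k}" using st by blast
  then have "finite (range st)" by (rule finite_subset) (simp add: assms(1))
  moreover have "sset ?ss = (\<lambda>(h, d). upper_path d h (h \<otimes> s d)) ` range st"
    unfolding sset_range image_image case_prod_beta
    by (rule image_cong[OF refl]) (rule snth[unfolded case_prod_beta])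
  ultimately have "finite (sset ?ss)" by simp
  then have cycle: "set (roof_edge_cycle G s k g) = (\<Union>n. set (?ss !! n))"
    unfolding roof_edge_cycle_def roof_walk_def
  proof (intro set_until_repetition_flat[where f = "roof_next G s k"])
    show "successively (\<lambda>x y. y = roof_next G s k x) (?ss !! n)" for n
      unfolding snth using st[of n] by (intro successively_upper_path) auto
    show "hd (?ss !! Suc n) = roof_next G s k (last (?ss !! n))" for n
      unfolding snth path_ends by (simp add: Suc roof_next_def)
  qed (simp_all only: snth path_ends not_False_eq_True)
  have "A_vtx h k 4 \<in> set (roof_edge_cycle G s k g)
      \<longleftrightarrow> (\<exists>n. snd (st n) = k \<and> h = fst (st n) \<otimes> s (snd (st n)))" for h
    unfolding cycle snth by (auto simp: A_vtx_in_upper_path)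
  then have "H_vis G s k g
      = {h \<in> carrier G. \<exists>n. snd (st n) = k \<and> h = fst (st n) \<otimes> s (snd (st n))}"
    unfolding H_vis_def by simp
  also have "\<dots> = {fst (st (Suc n)) | n. snd (st n) = k}"
    using st[of "Suc _"] by (force simp: Suc)
  also have "\<dots> = range (\<lambda>q. g \<otimes> ?p k [^] Suc q)"
  proof (intro equalityI subsetI)
    fix x assume "x \<in> {fst (st (Suc n)) | n. snd (st n) = k}"
    then obtain n where n: "x = fst (st (Suc n))" "Suc (n mod k) = k"
      unfolding st_eq by auto
    \<comment> \<open>Colour \<open>k\<close> means remainder \<open>k - 1\<close>, so this path
      closes a round.\<close>
    have "Suc n mod k = 0" "Suc n div k = Suc (n div k)"
      using n(2) by (simp_all add: mod_Suc div_Suc)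
    then have "x = g \<otimes> ?p k [^] Suc (n div k)"
      unfolding n(1) st_eq fst_conv using p by simp
    then show "x \<in> range (\<lambda>q. g \<otimes> ?p k [^] Suc q)" by blast
  next
    fix x assume "x \<in> range (\<lambda>q. g \<otimes> ?p k [^] Suc q)"
    then obtain q where q: "x = g \<otimes> ?p k [^] Suc q" by blast
    \<comment> \<open>With \<open>r = k - 1\<close>, path number \<open>q * k + r\<close>, counted
      from 0, is the last one of the round after \<open>q\<close> complete rounds, so its colour is
      \<open>k\<close>.\<close>
    obtain r where r: "Suc r = k" using assms(3) by (cases k) auto
    define n where "n = q * k + r"
    have "r < k" using r by simp
    then have "n mod k = r" "n div k = q" by (simp_all add: n_def)
    moreover from this have "Suc n mod k = 0" "Suc n div k = Suc q"
      using r by (simp_all add: mod_Suc div_Suc)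
    ultimately have "x = fst (st (Suc n))" "snd (st n) = k"
      unfolding q st_eq fst_conv snd_conv using p r by simp_all
    then show "x \<in> {fst (st (Suc n)) | n. snd (st n) = k}" by blast
  qed
  also have "\<dots> = g <# generate G {?p k}"
    unfolding generate_singleton_finite_pos[OF assms(1) p] l_coset_def by auto
  finally show ?thesis .
qed

lemma H_vis_bar_eq:
  assumes "finite (carrier G)" and "s d \<in> carrier G" and "d \<in> {1..k}" and "g \<in> carrier G"
  shows "H_vis_bar G s k d g = g <# generate G {s d}"
proof -
  define st where "st n = g \<otimes> s d [^] n" for n :: nat
  let ?ss = "smap (\<lambda>h. lower_path d h (h \<otimes> s d) @ (if k = 1 then [] else [C_vtx (h \<otimes> s d) d 1]))
    (siterate (\<lambda>h. h \<otimes> s d) g)"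
  have st: "st n \<in> carrier G" for n using assms by (simp add: st_def)
  have Suc: "st (Suc n) = st n \<otimes> s d" for n using assms by (simp add: st_def m_assoc)
  have snth: "?ss !! n = lower_path d (st n) (st n \<otimes> s d)
      @ (if k = 1 then [] else [C_vtx (st n \<otimes> s d) d 1])" for n
    by (simp add: base_state[OF assms(2,4)] st_def)
  have "range st \<subseteq> carrier G" using st by blast
  then have "finite (range st)" by (rule finite_subset) (rule assms(1))
  moreover have "sset ?ss = (\<lambda>h. lower_path d h (h \<otimes> s d)
      @ (if k = 1 then [] else [C_vtx (h \<otimes> s d) d 1])) ` range st"
    unfolding sset_range image_image by (rule image_cong[OF refl]) (rule snth)
  ultimately have "finite (sset ?ss)" by simp
  then have cycle: "set (base_edge_cycle G s k d g) = (\<Union>n. set (?ss !! n))"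
    unfolding base_edge_cycle_def base_walk_def
  proof (intro set_until_repetition_flat[where f = "base_next G s k"])
    show "successively (\<lambda>x y. y = base_next G s k x) (?ss !! n)" for n
      unfolding snth using assms(3)
      by (simp add: successively_append_iff successively_lower_path path_ends)
        (simp add: base_next_def)
    \<comment> \<open>A block ends at index 3 of \<open>A_vtx\<close> if \<open>k = 1\<close> and at
      a \<open>C_vtx\<close> otherwise; \<open>base_next\<close> sends both to the index 2 vertex
      that begins the next block.\<close>
    show "hd (?ss !! Suc n) = base_next G s k (last (?ss !! n))" for n
      unfolding snth by (simp add: path_ends Suc base_next_def)
  qed (simp_all only: snth path_ends append_is_Nil_conv not_False_eq_True simp_thms)
  have "H_vis_bar G s k d g = range st"
  proof (intro equalityI subsetI)
    fix h assume "h \<in> H_vis_bar G s k d g"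
    then obtain n v where "v \<in> set (?ss !! n)" "v \<in> uverts (blow_up_graph k h)"
      unfolding H_vis_bar_def cycle by blast
    \<comment> \<open>Apart from chain vertices, a block meets only the blow-up graphs of its source
      and its target.\<close>
    then have "h = st n \<or> h = st (Suc n)"
      unfolding snth Suc
      by (cases v) (auto simp: lower_path_def blow_up_graph_owner(1)
          dest: blow_up_graph_owner(2,3) split: if_splits)
    then show "h \<in> range st" by blast
  next
    fix h assume "h \<in> range st"
    then obtain n where n: "h = st n" by blast
    have "A_vtx h d 2 \<in> set (?ss !! n)" unfolding snth n by (simp add: lower_path_def)
    then show "h \<in> H_vis_bar G s k d g"
      unfolding H_vis_bar_def cycle mem_Collect_eq
      using A_vtx_in_blow_up_graph[OF assms(3), of h] st[of n] n by blast
  qed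
  \<comment> \<open>Exponent 0 occurs here, unlike for the roof walk, since the starting element
    itself counts as visited.\<close>
  also have "\<dots> = g <# generate G {s d}"
    unfolding generate_singleton_finite[OF assms(1,2)] l_coset_def st_def by auto
  finally show ?thesis .
qed

end

theorem lemma5p1:
  fixes G :: "('a, 'm) monoid_scheme" (structure)
    and S :: "'a set" and s :: "nat \<Rightarrow> 'a" and k :: nat and g :: 'a
  assumes "group G" and "finite (carrier G)"
    and "1 \<le> k"
    and "bij_betw s {1..k} S"
    and "S \<subseteq> carrier G" and "generate G S = carrier G"
    and "g \<in> carrier G"
  shows "H_vis G s k g = g <# generate G {ordered_prod G s k} \<and>
    (\<forall>d\<in>{1..k}. H_vis_bar G s k d g = g <# generate G {s d})"
proof -
  have s: "s ` {1..k} \<subseteq> carrier G"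
    using assms(4,5) by (simp add: bij_betw_def)
  then show ?thesis
    using group.H_vis_eq[OF assms(1,2) s assms(3,7)] group.H_vis_bar_eq[OF assms(1,2) _ _ assms(7)]
    by (simp add: image_subset_iff)
qed

end
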